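(* For complex $a,b,m,x$, $$\sum_{n=0}^{\infty}\frac{\bigl((-1)^n+1\bigr)\bigl(xe^{-bx^2}\bigr)^n\,(a+b(m+n))^{n/2}}{2\,\Gamma\!\left(\frac{n+2}{2}\right)}=\frac{e^{ax^2}x^m\bigl(xe^{-bx^2}\bigr)^{-m}}{1-2bx^2}.$$
   Context: $\Gamma$ is the Euler gamma function.
   Formalization: Added, as the identity fails for general complex parameters: with t=2bx², |t|<1 and |t e^{1-t}|≤1; x≠0 or m=0; and m is an integer or Ln x − bx² is the principal logarithm of x e^{-bx²}. Powers are principal, with z^0=1. *)

theory Defs
  imports "HOL-Complex_Analysis.Complex_Analysis"
begin

text \<open>
  Principal complex power with the convention \<open>z\<^sup>0 = 1\<close> for every \<open>z\<close>, including \<open>z = 0\<close>.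
  The library function \<open>powr\<close> has \<open>0 powr 0 = 0\<close>, which would give the wrong term \<open>n = 0\<close>
  of the series when \<open>a + b m = 0\<close>.
\<close>
definition cpow :: "complex \<Rightarrow> complex \<Rightarrow> complex" where
  "cpow z w = (if w = 0 then 1 else z powr w)"

text \<open>
  The range of parameters. With \<open>t = 2 b x\<^sup>2\<close> the nonzero terms grow like
  \<open>(t exp (1 - t))\<^sup>k / sqrt k\<close> (\<open>n = 2 k\<close>, \<open>b\<close> and \<open>x\<close> nonzero), so the series diverges where
  \<open>norm (t * exp (1 - t)) > 1\<close>. For fixed \<open>a + b m\<close> and \<open>b\<close>
  the series depends only on \<open>t exp (- t)\<close>, and where it converges it gives the value of the
  right-hand side at the preimage in the unit disc, so \<open>norm t < 1\<close> selects that preimage. On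
  the unit circle the convergence bound leaves only \<open>t = 1\<close>, where the right-hand side has a
  pole.
\<close>
definition convergence_range :: "complex \<Rightarrow> complex \<Rightarrow> bool" where
  "convergence_range b x \<longleftrightarrow>
     norm (2 * b * x\<^sup>2) < 1 \<and> norm (2 * b * x\<^sup>2 * exp (1 - 2 * b * x\<^sup>2)) \<le> 1"

text \<open>
  The powers \<open>x\<^sup>m\<close> and \<open>(x exp (- b x\<^sup>2))\<^sup>-\<^sup>m\<close> are defined, and their principal values are
  compatible: either \<open>m\<close> is an integer, or \<open>Ln x - b x\<^sup>2\<close> is itself the principal logarithm of
  \<open>x exp (- b x\<^sup>2)\<close>. (Otherwise the two logarithms differ by a nonzero multiple of \<open>2 \<pi> i\<close>, and
  the identity picks up a spurious factor.)
\<close>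
definition compatible_powers :: "complex \<Rightarrow> complex \<Rightarrow> complex \<Rightarrow> bool" where
  "compatible_powers b m x \<longleftrightarrow>
     (x \<noteq> 0 \<or> m = 0) \<and> (m \<in> \<int> \<or> Im (Ln x - b * x\<^sup>2) \<in> {-pi<..pi})"

end

theory Submission
  imports Defs
begin

text \<open>
  Only even \<open>n = 2 k\<close> contribute. For \<open>b \<noteq> 0\<close>, with \<open>t = 2 b x\<^sup>2\<close>, \<open>c = t exp (- t)\<close> and
  \<open>2 b g = a + b m\<close> the claim becomes
  \<open>(\<Sum>k. (g + k)\<^sup>k c\<^sup>k / k!) = exp (g t) / (1 - t)\<close>. By Cauchy's formula
  \<open>(g + k)\<^sup>k / k!\<close> is the contour integral of \<open>exp ((g + k) u) / u\<^bsup>k + 1\<^esup> / (2 \<pi> i)\<close> over the unit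
  circle, so a partial sum is the integral of a geometric sum with ratio \<open>q = c exp u / u\<close>, namely
  of \<open>exp (g u) (1 - q\<^sup>N) / (u - c exp u)\<close>. As \<open>norm q < 1\<close> on the circle except at \<open>u = 1\<close>, the
  part with \<open>q\<^sup>N\<close> vanishes by dominated convergence, even on the boundary of the disc of
  convergence. The rest has a single simple pole in the disc, at \<open>t\<close>, because
  \<open>u \<mapsto> c exp u\<close> is a strict contraction there.
\<close>

section \<open>Fixed points of \<open>u = c * exp u\<close> in the closed unit disc\<close>

lemma norm_exp_diff_le:
  fixes u v :: complex
  assumes "Re u \<le> M" "Re v \<le> M"
  shows "norm (exp u - exp v) \<le> exp M * norm (u - v)"
proof (rule field_differentiable_bound[where S = "{z. Re z \<le> M}" and f' = exp])
  show "convex {z. Re z \<le> M}"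
    by (rule convex_halfspace_Re_le)
  show "\<And>z. z \<in> {z. Re z \<le> M} \<Longrightarrow> (exp has_field_derivative exp z) (at z within {z. Re z \<le> M})"
    by (auto intro!: derivative_eq_intros)
qed (use assms in auto)

text \<open>The segment from u to t is cut at its midpoint \<open>p\<close>. On the half from
  \<open>p\<close> to t the real part is at most \<open>L < M\<close>, so this half alone makes the
  mean value bound strict.\<close>

lemma norm_exp_diff_less:
  fixes u t :: complex
  assumes "Re u \<le> M" "Re t < M" "u \<noteq> t"
  shows "norm (exp u - exp t) < exp M * norm (u - t)"
proof -
  define p where "p = (u + t) / 2"
  define L where "L = max (Re p) (Re t)"
  have "Re p < M"
    using assms by (simp add: p_def)
  then have "L < M"
    using assms by (simp add: L_def)
  have d: "norm (u - p) = norm (u - t) / 2" "norm (p - t) = norm (u - t) / 2"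
  proof -
    have "u - p = (u - t) / 2" "p - t = (u - t) / 2"
      by (simp_all add: p_def field_simps)
    then show "norm (u - p) = norm (u - t) / 2" "norm (p - t) = norm (u - t) / 2"
      by (simp_all only: norm_divide norm_numeral)
  qed
  have "norm (exp u - exp t) \<le> norm (exp u - exp p) + norm (exp p - exp t)"
    by norm
  also have "\<dots> \<le> exp M * norm (u - p) + exp L * norm (p - t)"
    using assms \<open>Re p < M\<close> by (intro add_mono norm_exp_diff_le) (auto simp: L_def)
  also have "\<dots> < exp M * norm (u - p) + exp M * norm (p - t)"
    unfolding d using assms \<open>L < M\<close> by (intro add_strict_left_mono mult_strict_right_mono) auto
  also have "\<dots> = exp M * norm (u - t)"
    by (simp add: d)
  finally show ?thesis .
qed

text \<open>If the fixed points differed, subtracting their equations would give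
  \<open>norm (u - t) < norm (u - t)\<close>. The strict exponential bound is what covers the
  boundary case \<open>norm c * exp 1 = 1\<close>, where the Lipschitz constant is only bounded by
  1; it is available because t lies in the open disc.\<close>

lemma exp_fixpoint_unique:
  fixes t c u :: complex
  assumes "norm t < 1" "norm c * exp 1 \<le> 1" "t = c * exp t" "norm u \<le> 1" "u = c * exp u"
  shows "u = t"
proof (rule ccontr)
  assume "u \<noteq> t"
  have "c \<noteq> 0"
    using assms \<open>u \<noteq> t\<close> by auto
  have "Re u \<le> 1" "Re t < 1"
    using assms complex_Re_le_cmod[of u] complex_Re_le_cmod[of t] by linarith+
  have "u - t = c * (exp u - exp t)"
    using assms(3,5) by (simp add: right_diff_distrib)
  then have "norm (u - t) = norm c * norm (exp u - exp t)"
    by (metis norm_mult)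
  also have "\<dots> < norm c * (exp 1 * norm (u - t))"
    using norm_exp_diff_less[OF \<open>Re u \<le> 1\<close> \<open>Re t < 1\<close> \<open>u \<noteq> t\<close>] \<open>c \<noteq> 0\<close> by simp
  also have "\<dots> \<le> 1 * norm (u - t)"
    unfolding mult.assoc[symmetric] by (intro mult_right_mono assms) auto
  finally show False by simp
qed

section \<open>Contour integrals over the unit circle\<close>

lemma higher_deriv_exp_mult: "(deriv ^^ k) (\<lambda>z. exp (s * z)) = (\<lambda>z::complex. s ^ k * exp (s * z))"
proof (induction k)
  case (Suc k)
  have "deriv (\<lambda>z. s ^ k * exp (s * z)) z = s ^ Suc k * exp (s * z)" for z
    by (rule DERIV_imp_deriv) (auto intro!: derivative_eq_intros)
  then show ?case using Suc by auto
qed simp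

lemma contour_integral_exp_over_power:
  fixes s :: complex
  shows "((\<lambda>u. exp (s * u) / u ^ Suc k) has_contour_integral (2 * pi * \<i> * (s ^ k / fact k)))
           (circlepath 0 1)"
proof -
  have "((\<lambda>u. exp (s * u) / (u - 0) ^ Suc k) has_contour_integral
          (2 * pi * \<i> / fact k * (deriv ^^ k) (\<lambda>z. exp (s * z)) 0)) (circlepath 0 1)"
    by (rule Cauchy_has_contour_integral_higher_derivative_circlepath)
       (auto intro!: continuous_intros holomorphic_intros)
  then show ?thesis
    by (simp add: higher_deriv_exp_mult)
qed

lemma contour_integral_main_part:
  fixes t c g :: complex
  assumes "norm t < 1" "norm c * exp 1 \<le> 1" "t = c * exp t"
  shows "((\<lambda>u. exp (g * u) / (u - c * exp u)) has_contour_integral (2 * pi * \<i> * (exp (g * t) / (1 - t))))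
           (circlepath 0 1)"
proof -
  define D where "D = (\<lambda>z. z - c * exp z)"
  \<comment> \<open>Dividing the simple zero at t out of \<open>D\<close> and filling the gap with
    the derivative gives an entire function. The integrand is then \<open>exp (g * u) / H u\<close>
    over \<open>u - t\<close>, to which Cauchy's formula applies.\<close>
  define H where "H = (\<lambda>z. if z = t then deriv D t else (D z - D t) / (z - t))"
  have "D t = 0"
    using assms by (simp add: D_def)
  have "deriv D t = 1 - c * exp t"
    unfolding D_def by (rule DERIV_imp_deriv) (auto intro!: derivative_eq_intros)
  then have dD: "deriv D t = 1 - t"
    using assms(3) by simp
  have "D holomorphic_on UNIV"
    unfolding D_def by (intro holomorphic_intros)
  then have H: "H holomorphic_on UNIV"
    unfolding H_def by (rule pole_lemma) auto
  have nz: "H u \<noteq> 0" if "norm u \<le> 1" for u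
  proof (cases "u = t")
    case True
    then show ?thesis using assms(1) dD by (auto simp: H_def)
  next
    case False
    then have "D u \<noteq> 0"
      using exp_fixpoint_unique[OF assms that] unfolding D_def by (metis right_minus_eq)
    then show ?thesis using False \<open>D t = 0\<close> by (simp add: H_def)
  qed
  have hol: "(\<lambda>u. exp (g * u) / H u) holomorphic_on cball 0 1"
    using nz by (intro holomorphic_on_divide holomorphic_on_subset[OF H]) (auto intro!: holomorphic_intros)
  have "((\<lambda>u. exp (g * u) / H u / (u - t)) has_contour_integral (2 * pi * \<i> * (exp (g * t) / H t)))
           (circlepath 0 1)"
    using Cauchy_integral_circlepath_simple[OF hol, of t] assms(1) by simp
  moreover have "exp (g * u) / H u / (u - t) = exp (g * u) / (u - c * exp u)"
    if "u \<in> path_image (circlepath 0 1)" for u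
  proof -
    have "u \<noteq> t" using that assms(1) by auto
    then show ?thesis using \<open>D t = 0\<close> by (simp add: H_def D_def)
  qed
  ultimately have "((\<lambda>u. exp (g * u) / (u - c * exp u)) has_contour_integral
      (2 * pi * \<i> * (exp (g * t) / H t))) (circlepath 0 1)"
    by (rule has_contour_integral_eq)
  then show ?thesis
    using dD by (simp add: H_def)
qed

lemma norm_ratio_le_1:
  fixes c u :: complex
  assumes "norm c * exp 1 \<le> 1" "norm u = 1"
  shows "norm (c * exp u / u) \<le> 1"
proof -
  have "Re u \<le> 1"
    using complex_Re_le_cmod[of u] assms by simp
  then have "norm c * exp (Re u) \<le> norm c * exp 1"
    by (intro mult_left_mono) auto
  then show ?thesis
    using assms by (simp add: norm_divide norm_mult)
qed

text \<open>On the unit circle the ratio has norm \<open>norm c * exp (Re u)\<close>, and 1 is the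
  only point of the circle with real part 1.\<close>

lemma norm_ratio_less_1:
  fixes c u :: complex
  assumes "norm c * exp 1 \<le> 1" "norm u = 1" "u \<noteq> 1"
  shows "norm (c * exp u / u) < 1"
proof (cases "c = 0")
  case False
  have "Re u \<noteq> 1"
  proof
    assume "Re u = 1"
    moreover have "(Re u)\<^sup>2 + (Im u)\<^sup>2 = 1"
      using assms(2) cmod_power2[of u] by simp
    ultimately show False
      using assms(3) by (simp add: complex_eq_iff)
  qed
  then have "Re u < 1"
    using complex_Re_le_cmod[of u] assms by simp
  then have "norm c * exp (Re u) < norm c * exp 1"
    using False by simp
  then show ?thesis
    using assms by (simp add: norm_divide norm_mult)
qed auto

text \<open>\<open>norm (q u)\<close> need not stay uniformly below 1 near \<open>u = 1\<close>, so
  the powers need not converge uniformly. Pointwise convergence off that point suffices, with the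
  bound of \<open>F\<close> on the compact circle giving a constant dominating function.\<close>

lemma contour_integral_circlepath_power_tendsto_0:
  fixes F q :: "complex \<Rightarrow> complex"
  assumes F: "continuous_on (sphere 0 1) F" and q: "continuous_on (sphere 0 1) q"
    and le: "\<And>u. norm u = 1 \<Longrightarrow> norm (q u) \<le> 1"
    and less: "\<And>u. norm u = 1 \<Longrightarrow> u \<noteq> 1 \<Longrightarrow> norm (q u) < 1"
  shows "(\<lambda>N. contour_integral (circlepath 0 1) (\<lambda>u. F u * q u ^ N)) \<longlonglongrightarrow> 0"
proof -
  define p where "p = circlepath 0 1"
  define h where "h = (\<lambda>N s. F (p s) * q (p s) ^ N * (2 * pi * \<i> * exp (2 * pi * \<i> * s)))"
  have p: "p s = exp (2 * pi * \<i> * s)" for s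
    by (simp add: p_def circlepath)
  have np: "norm (p s) = 1" for s
    by (simp add: p)
  have cp: "continuous_on A p" for A
    unfolding p by (intro continuous_intros)
  have ch: "continuous_on {0..1} (h N)" for N
    unfolding h_def
    by (intro continuous_intros continuous_on_compose2[OF F] continuous_on_compose2[OF q] cp)
       (auto simp: np)
  obtain B where B: "\<And>u. norm u = 1 \<Longrightarrow> norm (F u) \<le> B"
    using compact_imp_bounded[OF compact_continuous_image[OF F compact_sphere]]
    by (force simp: bounded_iff)
  \<comment> \<open>The open interval omits the two parameters that are mapped to 1, so the
    integrand tends to 0 at every parameter that is left.\<close>
  have eq: "contour_integral p (\<lambda>u. F u * q u ^ N) = integral {0<..<1} (h N)" for N
    unfolding contour_integral_integral integral_open_interval_real[symmetric]
    by (rule integral_cong) (simp add: p_def vector_derivative_circlepath h_def)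
  have "(\<lambda>N. integral {0<..<1} (h N)) \<longlonglongrightarrow> integral {0<..<1::real} (\<lambda>_. 0)"
  proof (rule dominated_convergence(2)[where h = "\<lambda>_. B * (2 * pi)"])
    show "h N integrable_on {0<..<1}" for N
      using integrable_continuous_interval[OF ch] by (simp add: integrable_on_Icc_iff_Ioo)
    show "(\<lambda>_. B * (2 * pi)) integrable_on {0<..<1::real}"
      unfolding integrable_on_Icc_iff_Ioo[symmetric] by (rule integrable_const_ivl)
    show "norm (h N s) \<le> B * (2 * pi)" for N s
    proof -
      have "norm (F (p s)) * norm (q (p s)) ^ N \<le> B * 1"
        using B[OF np] le[OF np] order_trans[OF norm_ge_zero B[OF np]]
        by (intro mult_mono power_le_one) auto
      then show ?thesis
        by (simp add: h_def norm_mult norm_power)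
    qed
    show "(\<lambda>N. h N s) \<longlonglongrightarrow> 0" if "s \<in> {0<..<1}" for s
    proof -
      have "p s \<noteq> 1"
      proof
        assume "p s = 1"
        then obtain n :: int where "2 * pi * s = of_int (2 * n) * pi"
          by (auto simp: p exp_eq_1)
        then have "s = of_int n" by simp
        then show False using that by auto
      qed
      then have "(\<lambda>N. q (p s) ^ N) \<longlonglongrightarrow> 0"
        using less[OF np] by (intro LIMSEQ_power_zero) auto
      then show ?thesis
        unfolding h_def by (intro tendsto_mult_left_zero tendsto_mult_right_zero)
    qed
  qed
  then show ?thesis
    by (simp add: eq flip: p_def)
qed

section \<open>Summation of the series in normalised form\<close>

lemma sums_shifted_power_over_fact:
  fixes g t :: complex
  assumes t: "norm t < 1" and le: "norm (t * exp (1 - t)) \<le> 1"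
  shows "(\<lambda>k. (g + of_nat k) ^ k / fact k * (t * exp (- t)) ^ k) sums (exp (g * t) / (1 - t))"
proof -
  define c where "c = t * exp (- t)"
  define q where "q = (\<lambda>u. c * exp u / u)"
  define F where "F = (\<lambda>u. exp (g * u) / (u - c * exp u))"
  have tc: "t = c * exp t"
    by (simp add: c_def mult.assoc flip: exp_add)
  \<comment> \<open>Splitting \<open>exp (1 - t)\<close> turns the hypothesis into the statement
    that \<open>c\<close> lies in the closed disc of radius \<open>exp (- 1)\<close>.\<close>
  have c: "norm c * exp 1 \<le> 1"
    using le by (simp add: c_def norm_mult mult.assoc flip: exp_add)
  \<comment> \<open>A zero on the circle would be a fixed point, hence equal to t, whose norm is
    less than 1. This also keeps \<open>q\<close> away from 1 in the geometric sum.\<close>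
  have nz: "u - c * exp u \<noteq> 0" if "norm u = 1" for u
    using exp_fixpoint_unique[OF t c tc, of u] that t by auto
  let ?S = "\<lambda>N. \<Sum>k<N. (g + of_nat k) ^ k / fact k * c ^ k"
  have S: "((\<lambda>u. F u - F u * q u ^ N) has_contour_integral (2 * pi * \<i> * ?S N)) (circlepath 0 1)" for N
  proof -
    have "((\<lambda>u. \<Sum>k<N. c ^ k * (exp ((g + of_nat k) * u) / u ^ Suc k)) has_contour_integral
            (\<Sum>k<N. c ^ k * (2 * pi * \<i> * ((g + of_nat k) ^ k / fact k)))) (circlepath 0 1)"
      by (intro has_contour_integral_sum has_contour_integral_lmul
          contour_integral_exp_over_power) auto
    moreover have "(\<Sum>k<N. c ^ k * (2 * pi * \<i> * ((g + of_nat k) ^ k / fact k))) = 2 * pi * \<i> * ?S N"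
      by (simp add: sum_distrib_left mult_ac)
    moreover have "(\<Sum>k<N. c ^ k * (exp ((g + of_nat k) * u) / u ^ Suc k)) = F u - F u * q u ^ N"
      if "u \<in> path_image (circlepath 0 1)" for u
    proof -
      have "norm u = 1" using that by auto
      then have "u \<noteq> 0" by auto
      have "q u \<noteq> 1"
        using nz[OF \<open>norm u = 1\<close>] \<open>u \<noteq> 0\<close> by (auto simp: q_def)
      have "c ^ k * (exp ((g + of_nat k) * u) / u ^ Suc k) = exp (g * u) / u * q u ^ k" for k
        by (simp add: q_def power_mult_distrib power_divide distrib_right exp_add exp_of_nat_mult)
      then have "(\<Sum>k<N. c ^ k * (exp ((g + of_nat k) * u) / u ^ Suc k))
                  = exp (g * u) / u * ((1 - q u ^ N) / (1 - q u))"
        using \<open>q u \<noteq> 1\<close> by (simp only: sum_distrib_left[symmetric] sum_gp_strict if_False)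
      also have "\<dots> = exp (g * u) / (u * (1 - q u)) * (1 - q u ^ N)"
        by simp
      also have "u * (1 - q u) = u - c * exp u"
        using \<open>u \<noteq> 0\<close> by (simp add: q_def field_simps)
      finally show ?thesis
        by (simp add: F_def right_diff_distrib)
    qed
    ultimately show ?thesis
      by (metis (no_types, lifting) has_contour_integral_eq)
  qed
  have main: "(F has_contour_integral (2 * pi * \<i> * (exp (g * t) / (1 - t)))) (circlepath 0 1)"
    unfolding F_def by (rule contour_integral_main_part[OF t c tc])
  \<comment> \<open>Subtracting the integral of the partial sum from that of \<open>F\<close> shows
    that the integral of the remainder is the error of the partial sum, up to the factor 2 pi
    i.\<close>
  have "((\<lambda>u. F u * q u ^ N) has_contour_integral
          (2 * pi * \<i> * (exp (g * t) / (1 - t) - ?S N))) (circlepath 0 1)" for N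
    using has_contour_integral_diff[OF main S[of N]] by (simp add: right_diff_distrib)
  then have "contour_integral (circlepath 0 1) (\<lambda>u. F u * q u ^ N)
      = 2 * pi * \<i> * (exp (g * t) / (1 - t) - ?S N)" for N
    by (rule contour_integral_unique)
  moreover have "(\<lambda>N. contour_integral (circlepath 0 1) (\<lambda>u. F u * q u ^ N)) \<longlonglongrightarrow> 0"
  proof (rule contour_integral_circlepath_power_tendsto_0)
    show "continuous_on (sphere 0 1) F"
      unfolding F_def using nz by (intro continuous_intros) auto
    show "continuous_on (sphere 0 1) q"
      unfolding q_def by (intro continuous_intros) auto
  qed (auto simp: q_def intro: norm_ratio_le_1[OF c] norm_ratio_less_1[OF c])
  ultimately have "(\<lambda>N. 2 * pi * \<i> * (exp (g * t) / (1 - t) - ?S N)) \<longlonglongrightarrow> 0"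
    by simp
  then have "(\<lambda>N. 2 * pi * \<i> * (exp (g * t) / (1 - t) - ?S N) / (2 * pi * \<i>)) \<longlonglongrightarrow> 0 / (2 * pi * \<i>)"
    by (rule tendsto_divide) auto
  then have "(\<lambda>N. exp (g * t) / (1 - t) - ?S N) \<longlonglongrightarrow> 0"
    by simp
  then have "(\<lambda>N. exp (g * t) / (1 - t) - (exp (g * t) / (1 - t) - ?S N)) \<longlonglongrightarrow> exp (g * t) / (1 - t) - 0"
    by (intro tendsto_diff tendsto_const)
  then show ?thesis
    by (simp add: sums_def c_def)
qed

section \<open>Complex powers and the original series\<close>

lemma cpow_of_nat: "cpow z (of_nat k) = z ^ k"
  by (cases "k = 0") (auto simp: cpow_def powr_nat')

text \<open>Compatibility makes the factors x^m and x^(-m) cancel, leaving only the exponential. For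
  integer m the laws of integer powers do this with no choice of branch; in the other case
  \<open>Ln\<close> of the product is \<open>Ln x - b * x\<^sup>2\<close>. For \<open>m = 0\<close>
  both powers are 1, even at \<open>x = 0\<close>.\<close>

lemma cpow_mult_cpow_minus:
  assumes "compatible_powers b m x"
  shows "cpow x m * cpow (x * exp (- (b * x\<^sup>2))) (- m) = exp (b * m * x\<^sup>2)"
proof (cases "m = 0")
  case False
  let ?z = "x * exp (- (b * x\<^sup>2))"
  have "x \<noteq> 0"
    using assms False by (simp add: compatible_powers_def)
  consider k where "m = of_int k" | "Im (Ln x - b * x\<^sup>2) \<in> {-pi<..pi}"
    using assms by (auto simp: compatible_powers_def elim: Ints_cases)
  then show ?thesis
  proof cases
    case 1
    have powi: "z powr of_int j = z powi j" if "z \<noteq> 0" for z :: complex and j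
      using that exp_power_int[of "Ln z" j] by (simp add: powr_def)
    have "x powr m * ?z powr (- m) = x powi k * ?z powi (- k)"
      using \<open>x \<noteq> 0\<close> powi[of x k] powi[of ?z "- k"] by (simp add: 1)
    then have "x powr m * ?z powr (- m) = exp (- (b * x\<^sup>2)) powi (- k)"
      using \<open>x \<noteq> 0\<close> by (simp add: power_int_mult_distrib power_int_minus)
    also have "\<dots> = exp (of_int (- k) * (- (b * x\<^sup>2)))"
      by (rule exp_power_int)
    finally show ?thesis
      using False 1 by (simp add: cpow_def mult_ac)
  next
    case 2
    have "?z = exp (Ln x - b * x\<^sup>2)"
      using \<open>x \<noteq> 0\<close> by (simp add: exp_diff exp_minus field_simps)
    then have "Ln ?z = Ln x - b * x\<^sup>2"
      using 2 by simp
    then show ?thesis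
      using \<open>x \<noteq> 0\<close> False
      by (simp add: cpow_def powr_def right_diff_distrib mult_ac flip: exp_add)
  qed
qed (simp add: cpow_def)

theorem proposition3p32:
  fixes a b m x :: complex
  assumes "convergence_range b x"
    and "compatible_powers b m x"
  shows "(\<lambda>n::nat. ((-1) ^ n + 1) * (x * exp (- (b * x\<^sup>2))) ^ n
                     * cpow (a + b * (m + of_nat n)) (of_nat n / 2)
                     / (2 * Gamma ((of_nat n + 2) / 2)))
         sums (exp (a * x\<^sup>2) * cpow x m * cpow (x * exp (- (b * x\<^sup>2))) (- m)
                 / (1 - 2 * b * x\<^sup>2))"
    (is "?f sums ?R")
proof -
  have R: "?R = exp ((a + b * m) * x\<^sup>2) / (1 - 2 * b * x\<^sup>2)"
    using cpow_mult_cpow_minus[OF assms(2)] by (simp add: mult.assoc distrib_right exp_add)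
  \<comment> \<open>For even index the sign factor is 2 and cancels against the denominator, the
    exponent n/2 is the natural number k, and the Gamma value is k!.\<close>
  have even: "?f (2 * k) = (a + b * m + 2 * b * of_nat k) ^ k / fact k * (x\<^sup>2 * exp (- (2 * b * x\<^sup>2))) ^ k"
    for k
  proof -
    have "(of_nat (2 * k) + 2) / 2 = (1 + of_nat k :: complex)"
      by (simp add: field_simps)
    then have "Gamma ((of_nat (2 * k) + 2) / 2) = (fact k :: complex)"
      by (simp only: Gamma_fact)
    moreover have "cpow z (of_nat (2 * k) / 2) = z ^ k" for z
      using cpow_of_nat[of z k] by simp
    moreover have "(x * exp (- (b * x\<^sup>2))) ^ (2 * k) = (x\<^sup>2 * exp (- (2 * b * x\<^sup>2))) ^ k"
      by (simp add: power_mult power_mult_distrib mult.assoc flip: exp_double)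
    ultimately show ?thesis
      by (simp add: algebra_simps)
  qed
  have "(\<lambda>k. (a + b * m + 2 * b * of_nat k) ^ k / fact k * (x\<^sup>2 * exp (- (2 * b * x\<^sup>2))) ^ k)
          sums (exp ((a + b * m) * x\<^sup>2) / (1 - 2 * b * x\<^sup>2))"
  \<comment> \<open>The substitution below divides by b; for \<open>b = 0\<close> the series is the
    exponential series of \<open>a * x\<^sup>2\<close>.\<close>
  proof (cases "b = 0")
    case True
    then show ?thesis
      using exp_converges[of "a * x\<^sup>2"]
      by (simp add: scaleR_conv_of_real power_mult_distrib field_simps)
  next
    case False
    define t where "t = 2 * b * x\<^sup>2"
    \<comment> \<open>Chosen so that the base of the k-th power is
      \<open>2 * b * (g + of_nat k)\<close>; the factor \<open>(2 * b) ^ k\<close> then turns the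
      powers of \<open>x\<^sup>2\<close> into powers of \<open>t\<close>.\<close>
    define g where "g = (a + b * m) / (2 * b)"
    have "norm t < 1" "norm (t * exp (1 - t)) \<le> 1"
      using assms(1) by (simp_all add: convergence_range_def t_def)
    from sums_shifted_power_over_fact[OF this, of g]
    have "(\<lambda>k. (g + of_nat k) ^ k / fact k * (t * exp (- t)) ^ k) sums (exp (g * t) / (1 - t))" .
    moreover have "g * t = (a + b * m) * x\<^sup>2"
      using False by (simp add: g_def t_def)
    moreover have "(g + of_nat k) ^ k / fact k * (t * exp (- t)) ^ k
        = (a + b * m + 2 * b * of_nat k) ^ k / fact k * (x\<^sup>2 * exp (- t)) ^ k" for k
    proof -
      have "a + b * m + 2 * b * of_nat k = 2 * b * (g + of_nat k)"
        using False by (simp add: g_def field_simps)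
      then have "(a + b * m + 2 * b * of_nat k) ^ k = (2 * b) ^ k * (g + of_nat k) ^ k"
        by (simp only: power_mult_distrib)
      moreover have "(t * exp (- t)) ^ k = (2 * b) ^ k * (x\<^sup>2 * exp (- t)) ^ k"
        by (simp add: t_def power_mult_distrib mult_ac)
      ultimately show ?thesis
        by simp
    qed
    ultimately show ?thesis
      by (simp only: t_def[symmetric])
  qed
  then have "(\<lambda>k. ?f (2 * k)) sums ?R"
    unfolding even R .
  moreover have "?f n = 0" if "n \<notin> range (\<lambda>k. 2 * k)" for n
  proof -
    have "odd n" using that by (auto elim: evenE)
    then show ?thesis by simp
  qed
  ultimately show ?thesis
    by (subst sums_mono_reindex[of "\<lambda>k. 2 * k", symmetric]) (auto simp: strict_mono_def)
qed

end
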